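(* Let $T:\operatorname{Lip}(X,E)\to\operatorname{Lip}(Y,F)$ be a biseparating map, where $X,Y$ are complete bounded metric spaces and $E,F$ are nontrivial Banach spaces. Represent $T$ as $$Tf(y)=\Phi(y,f(\varphi^{-1}(y)))\quad\text{for all } y\in Y\text{ and all } f\in\operatorname{Lip}(X,E),$$ where $\varphi:X\to Y$ is a homeomorphism and $\Phi:Y\times E\to F$ is a function such that $\Phi(y,\cdot):E\to F$ is a bijection for all $y\in Y$. Then $\varphi:X\to Y$ is a Lipschitz homeomorphism.
   Context: $\operatorname{Lip}(X,E)$ is the space of all Lipschitz functions $X\to E$. A Lipschitz homeomorphism is a bijection $\varphi$ such that both $\varphi$ and $\varphi^{-1}$ are Lipschitz. For a function $f$ let $C(f)=\{x: f(x)\neq 0\}$, and write $f\perp_h g$ if $C(f-h)\cap C(g-h)=\emptyset$. A map $T$ (not assumed linear) between two function spaces is biseparating if it is a bijection and for all $f,g,h$ in its domain: $f\perp_h g\iff Tf\perp_{Th}Tg$. The paper shows that every such biseparating $T$ has a representation of the stated form. *)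

theory Defs
  imports "HOL-Analysis.Analysis"
begin

text \<open>Metric spaces are types of class \<open>metric_space\<close>; the whole space is \<open>UNIV\<close>.\<close>

definition Lip :: "('x::metric_space \<Rightarrow> 'e::metric_space) set" where
  "Lip = {f. \<exists>L. L-lipschitz_on UNIV f}"

definition lipschitz_homeomorphism :: "('x::metric_space \<Rightarrow> 'y::metric_space) \<Rightarrow> bool" where
  "lipschitz_homeomorphism \<phi> \<longleftrightarrow> bij \<phi> \<and> \<phi> \<in> Lip \<and> inv \<phi> \<in> Lip"

definition carrier_set :: "('x \<Rightarrow> 'e::zero) \<Rightarrow> 'x set" where
  "carrier_set f = {x. f x \<noteq> 0}"

definition perp_at :: "('x \<Rightarrow> 'e::real_normed_vector) \<Rightarrow> ('x \<Rightarrow> 'e) \<Rightarrow> ('x \<Rightarrow> 'e) \<Rightarrow> bool" where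
  "perp_at h f g \<longleftrightarrow>
     carrier_set (\<lambda>x. f x - h x) \<inter> carrier_set (\<lambda>x. g x - h x) = {}"

text \<open>\<open>T\<close> is only relevant on \<open>A\<close>, and no linearity is assumed.\<close>

definition biseparating ::
  "('x \<Rightarrow> 'e::real_normed_vector) set \<Rightarrow> ('y \<Rightarrow> 'f::real_normed_vector) set \<Rightarrow>
     (('x \<Rightarrow> 'e) \<Rightarrow> ('y \<Rightarrow> 'f)) \<Rightarrow> bool" where
  "biseparating A B T \<longleftrightarrow> bij_betw T A B \<and>
     (\<forall>f\<in>A. \<forall>g\<in>A. \<forall>h\<in>A. perp_at h f g \<longleftrightarrow> perp_at (T h) (T f) (T g))"

end

theory Submission
  imports Defs
begin

text \<open>Write \<open>T f = (\<lambda>y. \<Phi> y (f (\<phi>\<inverse> y)))\<close> and \<open>T\<inverse> g = (\<lambda>x. \<Psi> x (g (\<phi> x)))\<close> with \<open>\<Psi> x\<close> inverse to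
  \<open>\<Phi> (\<phi> x)\<close>.  The proof rests on both operators preserving Lipschitz functions, which
  is symmetric in the two spaces, so only \<open>\<phi>\<close> has to be treated.

  If \<open>\<phi>\<close> is not Lipschitz, there are pairs \<open>x n\<close>, \<open>x' n\<close> whose distance \<open>d n\<close> is \<open>o(e n)\<close>, where
  \<open>e n\<close> is the distance of their images.  A Lipschitz function on the codomain can be
  altered at \<open>\<phi> (x n)\<close> by an amount of order \<open>e n\<close> without altering it at \<open>\<phi> (x' n)\<close>.  Its preimage under
  \<open>T\<close> is then unaltered at \<open>x' n\<close>, so it changes by \<open>O(d n)\<close> only at \<open>x n\<close>.
  Chaining such alterations shows that the fibre map \<open>\<Psi> (x n)\<close> nearly
  collapses whole balls (\<open>fibre_displacement\<close>), although \<open>\<Phi> (\<phi> (x n))\<close> maps the values of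
  suitable Lipschitz functions, which are far apart, into such balls.

  How large these balls may be depends on the room around \<open>\<phi> (x n)\<close>.  If the images
  form separated sequences, a fixed radius is possible and constant functions give the
  contradiction (\<open>no_separated_pairs\<close>).  If the pairs converge to a point \<open>x0\<close>, the radius is
  of the order of the distance from \<open>\<phi> (x n)\<close> to \<open>\<phi> x0\<close> and the function \<open>\<lambda>x. dist x x0 *\<^sub>R w\<close>
  gives the contradiction (\<open>no_convergent_pairs\<close>), provided \<open>\<phi>\<close> satisfies a Lipschitz estimate
  at the single point \<open>x0\<close>.  That estimate (\<open>pointwise_lipschitz\<close>) is the subtle part: no
  single value at \<open>x0\<close> leads to a contradiction, and a suitable value is found by a Baire category
  argument.\<close>

section \<open>Lipschitz functions on a whole space\<close>

lemma LipI: "L-lipschitz_on UNIV f \<Longrightarrow> f \<in> Lip"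
  by (auto simp: Lip_def)

lemma LipD: "f \<in> Lip \<Longrightarrow> \<exists>L\<ge>0. \<forall>x y. dist (f x) (f y) \<le> L * dist x y"
  by (auto simp: Lip_def lipschitz_on_def)

lemma abs_dist_diff_left_le: "\<bar>dist x z - dist y z\<bar> \<le> dist x y"
  using abs_dist_diff_le[of x z y] by (simp add: dist_commute)

lemma Lip_const: "(\<lambda>x. c) \<in> Lip"
  by (rule LipI[OF lipschitz_on_constant])

lemma Lip_add:
  fixes f g :: "'x::metric_space \<Rightarrow> 'e::real_normed_vector"
  assumes "f \<in> Lip" "g \<in> Lip"
  shows "(\<lambda>x. f x + g x) \<in> Lip"
  using assms unfolding Lip_def by (blast intro: lipschitz_on_add)

lemma Lip_imp_continuous: "f \<in> Lip \<Longrightarrow> continuous_on UNIV f"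
  by (auto simp: Lip_def intro: lipschitz_on_continuous_on)

lemma Lip_dist_scaleR:
  fixes w :: "'e::real_normed_vector"
  shows "(\<lambda>x::'x::metric_space. dist x x0 *\<^sub>R w) \<in> Lip"
proof (rule LipI, rule lipschitz_onI)
  show "dist (dist x x0 *\<^sub>R w) (dist y x0 *\<^sub>R w) \<le> norm w * dist x y" for x y :: 'x
  proof -
    have "dist (dist x x0 *\<^sub>R w) (dist y x0 *\<^sub>R w) = \<bar>dist x x0 - dist y x0\<bar> * norm w"
      by (simp add: dist_norm flip: scaleR_left_diff_distrib)
    also have "\<dots> \<le> dist x y * norm w"
      by (intro mult_right_mono abs_dist_diff_left_le) auto
    finally show ?thesis by (simp add: mult.commute)
  qed
qed auto

section \<open>Subsequences\<close>

text \<open>Thinning a sequence so that each chosen term is in a prescribed relation to all earlier chosen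
  ones.  The next index only has to be good for all indices up to the last one chosen, so it
  can be produced by iterating a single function.\<close>

lemma diagonal_subsequence:
  fixes P :: "nat \<Rightarrow> nat \<Rightarrow> bool"
  assumes "\<And>k. \<exists>m>k. \<forall>n\<le>k. P n m"
  shows "\<exists>\<sigma>::nat \<Rightarrow> nat. strict_mono \<sigma> \<and> (\<forall>i j. i < j \<longrightarrow> P (\<sigma> i) (\<sigma> j))"
proof -
  obtain h where h: "\<And>k. h k > k" "\<And>k n. n \<le> k \<Longrightarrow> P n (h k)"
    using assms by metis
  define \<sigma> where "\<sigma> i = (h ^^ i) 0" for i
  have Suc: "\<sigma> (Suc i) = h (\<sigma> i)" for i by (simp add: \<sigma>_def)
  have mono: "strict_mono \<sigma>"
    by (simp add: strict_mono_Suc_iff Suc h)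
  have "P (\<sigma> i) (\<sigma> j)" if "i < j" for i j
  proof -
    from that obtain k where k: "j = Suc k" "i \<le> k" by (cases j) auto
    then show ?thesis using h(2)[of "\<sigma> i" "\<sigma> k"] mono
      by (simp add: Suc strict_mono_less_eq)
  qed
  with mono show ?thesis by blast
qed

lemma eventually_subsequence:
  fixes P :: "nat \<Rightarrow> nat \<Rightarrow> bool"
  assumes "\<And>n. eventually (P n) sequentially"
  shows "\<exists>\<sigma>::nat \<Rightarrow> nat. strict_mono \<sigma> \<and> (\<forall>i j. i < j \<longrightarrow> P (\<sigma> i) (\<sigma> j))"
proof (rule diagonal_subsequence[of P])
  fix k
  have "\<forall>\<^sub>F m in sequentially. \<forall>n\<in>{..k}. P n m"
    using assms by (simp add: eventually_ball_finite)
  then have "\<forall>\<^sub>F m in sequentially. m > k \<and> (\<forall>n\<in>{..k}. P n m)"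
    using eventually_gt_at_top eventually_conj by blast
  then show "\<exists>m>k. \<forall>n\<le>k. P n m"
    unfolding eventually_sequentially by (metis atMost_iff order_refl)
qed

text \<open>This is total boundedness in sequential form: if the closure of the range is not compact, then
  some \<open>e\<close> admits no finite cover by \<open>e\<close>-balls, and a new term outside the \<open>e/2\<close>-balls around
  all earlier terms can always be found.\<close>

lemma convergent_or_separated_subsequence:
  fixes p :: "nat \<Rightarrow> 'y::complete_space"
  obtains (convergent) \<sigma> :: "nat \<Rightarrow> nat" and l where "strict_mono \<sigma>" "(p \<circ> \<sigma>) \<longlonglongrightarrow> l"
  | (separated) \<sigma> :: "nat \<Rightarrow> nat" and \<epsilon> :: real
    where "strict_mono \<sigma>" "\<epsilon> > 0" "\<And>i j. i < j \<Longrightarrow> \<epsilon> \<le> dist (p (\<sigma> i)) (p (\<sigma> j))"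
proof (cases "compact (closure (range p))")
  case True
  then have "seq_compact (closure (range p))"
    by (simp add: compact_eq_seq_compact_metric)
  moreover have "p n \<in> closure (range p)" for n
    by (rule subsetD[OF closure_subset]) simp
  ultimately obtain l \<sigma> where "strict_mono \<sigma>" "(p \<circ> \<sigma>) \<longlonglongrightarrow> l"
    unfolding seq_compact_def by metis
  then show ?thesis by (rule convergent)
next
  case False
  moreover have "complete (closure (range p))"
    by (simp add: complete_eq_closed)
  ultimately obtain e where e: "e > 0"
    and nocover: "\<And>k. finite k \<Longrightarrow> \<not> closure (range p) \<subseteq> (\<Union>x\<in>k. ball x e)"
    by (auto simp: compact_eq_totally_bounded)
  have "\<exists>m>k. \<forall>n\<le>k. e/2 \<le> dist (p n) (p m)" for k
  proof (rule ccontr)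
    assume *: "\<not> ?thesis"
    have "p m \<in> (\<Union>n\<le>k. cball (p n) (e/2))" for m
    proof (cases "m \<le> k")
      case True
      then show ?thesis using e by (intro UN_I[of m]) auto
    next
      case False
      then obtain n where "n \<le> k" "dist (p n) (p m) < e/2"
        using * by (meson linorder_not_le)
      then show ?thesis by (intro UN_I[of n]) auto
    qed
    then have "range p \<subseteq> (\<Union>n\<le>k. cball (p n) (e/2))" by blast
    then have "closure (range p) \<subseteq> (\<Union>n\<le>k. cball (p n) (e/2))"
      by (intro closure_minimal closed_UN) auto
    also have "\<dots> \<subseteq> (\<Union>x\<in>p ` {..k}. ball x e)" using e by fastforce
    finally show False using nocover[of "p ` {..k}"] by blast
  qed
  from diagonal_subsequence[of "\<lambda>n m. e/2 \<le> dist (p n) (p m)", OF this]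
  obtain \<sigma> :: "nat \<Rightarrow> nat" where "strict_mono \<sigma>" "\<And>i j. i < j \<Longrightarrow> e/2 \<le> dist (p (\<sigma> i)) (p (\<sigma> j))"
    by blast
  with e show ?thesis by (intro separated[of \<sigma> "e/2"]) auto
qed

text \<open>By the triangle inequality at most one term of a separated sequence is near \<open>z\<close>.\<close>

lemma separated_eventually_away:
  fixes p :: "nat \<Rightarrow> 'y::metric_space"
  assumes "\<And>i j. i < j \<Longrightarrow> \<epsilon> \<le> dist (p i) (p j)"
  shows "\<forall>\<^sub>F m in sequentially. \<epsilon>/2 \<le> dist (p m) z"
proof (cases "\<exists>m0. dist (p m0) z < \<epsilon>/2")
  case True
  then obtain m0 where m0: "dist (p m0) z < \<epsilon>/2" ..
  have "\<epsilon>/2 \<le> dist (p m) z" if "m0 < m" for m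
    using assms[OF that] m0 dist_triangle2[of "p m0" "p m" z] by linarith
  then show ?thesis by (intro eventually_mono[OF eventually_gt_at_top[of m0]])
next
  case False
  then show ?thesis by (intro always_eventually) (auto simp: not_less)
qed

section \<open>Interpolation and chaining\<close>

text \<open>Banach-valued Lipschitz functions need not extend from subsets, so functions with prescribed
  values at infinitely many points are built as sums of cones.  The cone of height \<open>a i\<close> over the
  ball of radius \<open>R i\<close> has slope at most \<open>K\<close>, and since the balls are disjoint the slope of the
  sum is at most \<open>2 * K\<close>: a pair of points meets at most two of the cones.\<close>

lemma disjoint_bumps:
  fixes p :: "nat \<Rightarrow> 'y::metric_space" and a :: "nat \<Rightarrow> 'f::real_normed_vector"
  assumes sep: "\<And>i j. i \<noteq> j \<Longrightarrow> R i + R j \<le> dist (p i) (p j)"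
    and R: "\<And>i. 0 < R i" and a: "\<And>i. norm (a i) \<le> K * R i"
  shows "\<exists>g\<in>Lip. (\<forall>i. g (p i) = a i) \<and> (\<forall>y. (\<forall>i. R i \<le> dist y (p i)) \<longrightarrow> g y = 0)"
proof -
  define b where "b i y = max 0 (1 - dist y (p i) / R i) *\<^sub>R a i" for i y
  have b_diff: "norm (b i y - b i z) \<le> K * dist y z" for i y z
  proof -
    have "norm (b i y - b i z)
        = \<bar>max 0 (1 - dist y (p i) / R i) - max 0 (1 - dist z (p i) / R i)\<bar> * norm (a i)"
      by (simp add: b_def flip: scaleR_left_diff_distrib)
    also have "\<dots> \<le> \<bar>dist y (p i) / R i - dist z (p i) / R i\<bar> * norm (a i)"
      by (intro mult_right_mono) auto
    also have "\<dots> = \<bar>dist y (p i) - dist z (p i)\<bar> / R i * norm (a i)"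
      using R[of i] by (simp flip: diff_divide_distrib)
    also have "\<dots> \<le> dist y z / R i * (K * R i)"
      using R[of i] a[of i] by (intro mult_mono divide_right_mono abs_dist_diff_left_le) auto
    finally show ?thesis using R[of i] by (simp add: mult.commute)
  qed
  have b_0: "b i y = 0" if "R i \<le> dist y (p i)" for i y
    using that R[of i] by (simp add: b_def)
  have b_p: "b i (p i) = a i" for i by (simp add: b_def)
  have "\<exists>i. \<forall>j. j \<noteq> i \<longrightarrow> b j y = 0" for y
  proof (cases "\<exists>i. dist y (p i) < R i")
    case True
    then obtain i where i: "dist y (p i) < R i" ..
    have "R j \<le> dist y (p j)" if "j \<noteq> i" for j
      using sep[OF that] i dist_triangle2[of "p j" "p i" y] by (simp add: dist_commute)
    then show ?thesis using b_0 by blast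
  next
    case False
    then show ?thesis using b_0 by (meson not_less)
  qed
  \<comment> \<open>At every point at most one cone is nonzero; \<open>k y\<close> is the index of that cone, and arbitrary when all vanish.\<close>
  then obtain k where k: "\<And>y j. j \<noteq> k y \<Longrightarrow> b j y = 0" by metis
  define g where "g y = b (k y) y" for y
  have K: "0 \<le> K" using a[of 0] R[of 0] by (metis norm_ge_zero order_trans zero_le_mult_iff not_le)
  have "g \<in> Lip"
  proof (rule LipI, rule lipschitz_onI)
    fix y z
    show "dist (g y) (g z) \<le> 2 * K * dist y z"
    proof (cases "k y = k z")
      case True
      then have "dist (g y) (g z) \<le> K * dist y z"
        using b_diff by (simp add: g_def dist_norm)
      also have "\<dots> \<le> 2 * K * dist y z" using K by simp
      finally show ?thesis .
    next
      case False
      then have "g y - g z = (b (k y) y - b (k y) z) + (b (k z) y - b (k z) z)"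
        using k by (simp add: g_def)
      then have "dist (g y) (g z) \<le> norm (b (k y) y - b (k y) z) + norm (b (k z) y - b (k z) z)"
        by (metis dist_norm norm_triangle_ineq)
      then show ?thesis using b_diff[of "k y" y z] b_diff[of "k z" y z] by linarith
    qed
  qed (use K in auto)
  moreover have "g (p i) = a i" for i
  proof (cases "k (p i) = i")
    case True then show ?thesis by (simp add: g_def b_p)
  next
    case False
    then have "R (k (p i)) \<le> dist (p i) (p (k (p i)))"
      using sep[of i "k (p i)"] R[of i] by auto
    then show ?thesis using k[of i "p i"] False by (simp add: g_def b_0 b_p)
  qed
  moreover have "g y = 0" if "\<And>i. R i \<le> dist y (p i)" for y
    using that by (simp add: g_def b_0)
  ultimately show ?thesis by blast
qed

text \<open>Cut the segment into \<open>M\<close> equal steps: the increment of \<open>h\<close> from \<open>a\<close> to \<open>b\<close> is the sum of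
  the increments over the steps, so some step carries at least the average.  The fibre maps
  \<open>\<Psi> x\<close> below may be discontinuous, so large steps are found by this averaging and not by a mean
  value argument.\<close>

lemma segment_large_step:
  fixes h :: "'a::real_normed_vector \<Rightarrow> 'b::real_normed_vector"
  assumes ab: "norm (b - a) \<le> real M * r" and r: "0 \<le> r"
  obtains c c' where "c \<in> closed_segment a b" "c' \<in> closed_segment a b"
    "norm (c' - c) \<le> r" "norm (h b - h a) \<le> real M * norm (h c' - h c)"
proof (cases "M = 0")
  case True
  with ab r show ?thesis by (intro that[of a a]) auto
next
  case False
  define c where "c i = a + (real i / real M) *\<^sub>R (b - a)" for i
  have c: "c i \<in> closed_segment a b" if "i \<le> M" for i
  proof -
    have "c i = (1 - real i / real M) *\<^sub>R a + (real i / real M) *\<^sub>R b"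
      by (simp add: c_def algebra_simps)
    then show ?thesis using that False unfolding closed_segment_def
      by (intro CollectI exI[of _ "real i / real M"]) simp
  qed
  have step: "norm (c (Suc i) - c i) \<le> r" for i
  proof -
    have "c (Suc i) - c i = (1 / real M) *\<^sub>R (b - a)"
      unfolding c_def by (simp add: add_divide_distrib scaleR_add_left)
    then have "norm (c (Suc i) - c i) = norm (b - a) / real M" by simp
    then show ?thesis using ab False by (simp add: divide_le_eq mult.commute)
  qed
  have "\<exists>i<M. norm (h b - h a) \<le> real M * norm (h (c (Suc i)) - h (c i))"
  proof (rule ccontr)
    assume "\<not> ?thesis"
    then have small: "real M * norm (h (c (Suc i)) - h (c i)) < norm (h b - h a)" if "i < M" for i
      using that by force
    have "h b - h a = (\<Sum>i<M. h (c (Suc i)) - h (c i))"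
      using sum_lessThan_telescope[of "\<lambda>i. h (c i)" M] False by (simp add: c_def)
    then have "norm (h b - h a) \<le> (\<Sum>i<M. norm (h (c (Suc i)) - h (c i)))"
      by (simp add: norm_sum)
    then have "real M * norm (h b - h a) \<le> (\<Sum>i<M. real M * norm (h (c (Suc i)) - h (c i)))"
      by (simp add: mult_left_mono flip: sum_distrib_left)
    also have "\<dots> < (\<Sum>i<M. norm (h b - h a))"
      using False small by (intro sum_strict_mono) auto
    finally show False by simp
  qed
  then obtain i where "i < M" "norm (h b - h a) \<le> real M * norm (h (c (Suc i)) - h (c i))" by blast
  then show ?thesis using c[of i] c[of "Suc i"] step[of i] by (intro that[of "c i" "c (Suc i)"]) auto
qed

section \<open>Weighted compositions between Lipschitz spaces\<close>

text \<open>The operator \<open>f \<mapsto> (\<lambda>y. \<Phi> y (f (\<psi> y)))\<close> and its inverse \<open>g \<mapsto> (\<lambda>x. \<Psi> x (g (\<phi> x)))\<close> are given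
  side by side, where \<open>\<Psi> x\<close> is the inverse of the fibre map \<open>\<Phi> (\<phi> x)\<close>.  Exchanging the roles of
  the two spaces turns one instance into another as soon as both spaces are complete and
  bounded, so it suffices to prove that \<open>\<phi>\<close> is Lipschitz.\<close>

locale weighted_composition =
  fixes \<phi> :: "'x::metric_space \<Rightarrow> 'y::complete_space" and \<psi> :: "'y \<Rightarrow> 'x"
    and \<Phi> :: "'y \<Rightarrow> 'e::real_normed_vector \<Rightarrow> 'f::real_normed_vector"
    and \<Psi> :: "'x \<Rightarrow> 'f \<Rightarrow> 'e"
  assumes \<psi>_\<phi>: "\<psi> (\<phi> x) = x" and \<phi>_\<psi>: "\<phi> (\<psi> y) = y"
    and cont_\<phi>: "continuous_on UNIV \<phi>" and cont_\<psi>: "continuous_on UNIV \<psi>"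
    and \<Psi>_\<Phi>: "\<Psi> x (\<Phi> (\<phi> x) u) = u" and \<Phi>_\<Psi>: "\<Phi> y (\<Psi> (\<psi> y) v) = v"
    and Lip_\<Phi>: "f \<in> Lip \<Longrightarrow> (\<lambda>y. \<Phi> y (f (\<psi> y))) \<in> Lip"
    and Lip_\<Psi>: "g \<in> Lip \<Longrightarrow> (\<lambda>x. \<Psi> x (g (\<phi> x))) \<in> Lip"
    and bounded_codomain: "bounded (UNIV :: 'y set)"
    and nontrivial_e: "\<exists>u::'e. u \<noteq> 0" and nontrivial_f: "\<exists>v::'f. v \<noteq> 0"
begin

lemma dist_bound:
  obtains D where "D > 0" "\<And>y z :: 'y. dist y z \<le> D"
proof -
  obtain D where D: "\<And>y z :: 'y. dist y z \<le> D"
    using bounded_codomain unfolding bounded_two_points by auto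
  show ?thesis
  proof (rule that[of "max D 1"])
    show "dist y z \<le> max D 1" for y z :: 'y using D[of y z] by simp
  qed simp
qed

lemma tendsto_\<phi>: "x \<longlonglongrightarrow> x0 \<Longrightarrow> (\<lambda>n. \<phi> (x n)) \<longlonglongrightarrow> \<phi> x0"
  using cont_\<phi> by (rule continuous_on_tendsto_compose) auto

lemma tendsto_\<psi>: "y \<longlonglongrightarrow> y0 \<Longrightarrow> (\<lambda>n. \<psi> (y n)) \<longlonglongrightarrow> \<psi> y0"
  using cont_\<psi> by (rule continuous_on_tendsto_compose) auto

text \<open>If functions on the codomain may be altered near \<open>\<phi> (x n)\<close> without changing them at
  \<open>\<phi> (x' n)\<close>, then the values of their preimages at \<open>x n\<close> change by at most a constant multiple of
  \<open>dist (x n) (x' n)\<close>, because the values at \<open>x' n\<close> stay the same.  An alteration of slope at most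
  \<open>1\<close> supported in the ball of radius \<open>r n\<close> moves the value at \<open>\<phi> (x n)\<close> by at most \<open>r n\<close>, so going
  from \<open>a n\<close> to \<open>b n\<close> takes about \<open>R n / r n\<close> such moves.  The bound is uniform in \<open>n\<close> because, for each
  \<open>n\<close>, one move carrying at least the average displacement is singled out, and all of these moves
  are realised by a single pair of Lipschitz functions.\<close>

lemma fibre_displacement:
  fixes x x' :: "nat \<Rightarrow> 'x"
  assumes sep: "\<And>i j. i \<noteq> j \<Longrightarrow> R i + R j \<le> dist (\<phi> (x i)) (\<phi> (x j))"
    and r: "\<And>n. 0 < r n" "\<And>n. r n \<le> R n"
    and x': "\<And>n m. r m \<le> dist (\<phi> (x' n)) (\<phi> (x m))"
    and ab: "\<And>n. norm (a n - v) \<le> K * R n" "\<And>n. norm (b n - v) \<le> K * R n"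
  shows "\<exists>L\<ge>0. \<forall>n. norm (\<Psi> (x n) (b n) - \<Psi> (x n) (a n)) \<le> L * dist (x n) (x' n) * (R n / r n)"
proof -
  have R: "0 < R n" for n using r[of n] by linarith
  have "0 \<le> K * R 0" using ab(1)[of 0] norm_ge_zero order_trans by blast
  then have K: "0 \<le> K" using R[of 0] by (simp add: zero_le_mult_iff)
  define M where "M n = nat \<lceil>2 * K * (R n / r n)\<rceil>" for n
  have M_ge: "2 * K * (R n / r n) \<le> real (M n)" for n unfolding M_def by (rule real_nat_ceiling_ge)
  have M_le: "real (M n) \<le> (2 * K + 1) * (R n / r n)" for n
  proof -
    have "0 \<le> 2 * K * (R n / r n)" using K R[of n] r[of n] by simp
    then have "real (M n) \<le> 2 * K * (R n / r n) + 1" unfolding M_def by linarith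
    also have "1 \<le> R n / r n" using r[of n] by simp
    finally show ?thesis by (simp add: algebra_simps)
  qed
  have step_bound: "norm (b n - a n) \<le> real (M n) * r n" for n
  proof -
    have "norm (b n - a n) \<le> norm (b n - v) + norm (a n - v)"
      using norm_triangle_ineq4[of "b n - v" "a n - v"] by simp
    also have "\<dots> \<le> 2 * K * (R n / r n) * r n" using ab[of n] r[of n] by simp
    also have "\<dots> \<le> real (M n) * r n" using M_ge[of n] r[of n] by (intro mult_right_mono) auto
    finally show ?thesis .
  qed
  have "\<forall>n. \<exists>c c'. c \<in> closed_segment (a n) (b n) \<and> norm (c' - c) \<le> r n \<and>
      norm (\<Psi> (x n) (b n) - \<Psi> (x n) (a n)) \<le> real (M n) * norm (\<Psi> (x n) c' - \<Psi> (x n) c)"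
  proof
    fix n
    show "\<exists>c c'. c \<in> closed_segment (a n) (b n) \<and> norm (c' - c) \<le> r n \<and>
      norm (\<Psi> (x n) (b n) - \<Psi> (x n) (a n)) \<le> real (M n) * norm (\<Psi> (x n) c' - \<Psi> (x n) c)"
      using segment_large_step[OF step_bound less_imp_le[OF r(1)], of n "\<Psi> (x n)"] by metis
  qed
  then obtain c c' where c: "\<And>n. c n \<in> closed_segment (a n) (b n)"
    and cc': "\<And>n. norm (c' n - c n) \<le> r n"
    and step: "\<And>n. norm (\<Psi> (x n) (b n) - \<Psi> (x n) (a n))
                 \<le> real (M n) * norm (\<Psi> (x n) (c' n) - \<Psi> (x n) (c n))"
    by metis
  have c_v: "norm (c n - v) \<le> K * R n" for n
  proof -
    have "closed_segment (a n) (b n) \<subseteq> cball v (K * R n)"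
      using ab[of n] by (intro closed_segment_subset) (auto simp: dist_norm norm_minus_commute)
    then have "c n \<in> cball v (K * R n)" using c by blast
    then show ?thesis by (simp add: dist_norm norm_minus_commute)
  qed
  \<comment> \<open>\<open>v + g1\<close> takes the value \<open>c n\<close> at \<open>\<phi> (x n)\<close>; adding \<open>g2\<close> moves it to \<open>c' n\<close> without affecting \<open>\<phi> (x' n)\<close>.\<close>
  from disjoint_bumps[where p="\<lambda>n. \<phi> (x n)", OF sep R c_v]
  obtain g1 where g1: "g1 \<in> Lip" "\<And>n. g1 (\<phi> (x n)) = c n - v"
    by auto
  have sep': "r i + r j \<le> dist (\<phi> (x i)) (\<phi> (x j))" if "i \<noteq> j" for i j
    using sep[OF that] r(2)[of i] r(2)[of j] by linarith
  have "norm (c' n - c n) \<le> 1 * r n" for n using cc' by simp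
  from disjoint_bumps[where p="\<lambda>n. \<phi> (x n)", OF sep' r(1) this]
  obtain g2 where g2: "g2 \<in> Lip" "\<And>n. g2 (\<phi> (x n)) = c' n - c n" "\<And>n. g2 (\<phi> (x' n)) = 0"
    using x' by auto
  define f where "f = (\<lambda>x. \<Psi> x (v + g1 (\<phi> x)))"
  define f' where "f' = (\<lambda>x. \<Psi> x (v + g1 (\<phi> x) + g2 (\<phi> x)))"
  have "f \<in> Lip"
    unfolding f_def using Lip_\<Psi>[OF Lip_add[OF Lip_const g1(1)]] by simp
  then obtain L where L: "0 \<le> L" "\<And>x y. dist (f x) (f y) \<le> L * dist x y" using LipD by blast
  have "f' \<in> Lip"
    unfolding f'_def using Lip_\<Psi>[OF Lip_add[OF Lip_add[OF Lip_const g1(1)] g2(1)]] by simp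
  then obtain L' where L': "0 \<le> L'" "\<And>x y. dist (f' x) (f' y) \<le> L' * dist x y" using LipD by blast
  have main: "norm (\<Psi> (x n) (c' n) - \<Psi> (x n) (c n)) \<le> (L + L') * dist (x n) (x' n)" for n
  proof -
    have "f (x' n) = f' (x' n)" by (simp add: f_def f'_def g2)
    then have "dist (f' (x n)) (f (x n)) \<le> dist (f' (x n)) (f' (x' n)) + dist (f (x n)) (f (x' n))"
      using dist_triangle2[of "f' (x n)" "f (x n)" "f (x' n)"] by simp
    also have "\<dots> \<le> (L + L') * dist (x n) (x' n)"
      using L(2)[of "x n" "x' n"] L'(2)[of "x n" "x' n"] by (simp add: algebra_simps)
    finally show ?thesis by (simp add: f_def f'_def g1 g2 dist_norm)
  qed
  show ?thesis
  proof (intro exI[of _ "(2 * K + 1) * (L + L')"] conjI allI)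
    show "0 \<le> (2 * K + 1) * (L + L')" using K L L' by simp
    fix n
    have "norm (\<Psi> (x n) (b n) - \<Psi> (x n) (a n)) \<le> real (M n) * ((L + L') * dist (x n) (x' n))"
      by (rule order_trans[OF step mult_left_mono[OF main]]) simp
    also have "\<dots> \<le> (2 * K + 1) * (R n / r n) * ((L + L') * dist (x n) (x' n))"
      using M_le L L' by (intro mult_right_mono) auto
    finally show "norm (\<Psi> (x n) (b n) - \<Psi> (x n) (a n))
        \<le> (2 * K + 1) * (L + L') * dist (x n) (x' n) * (R n / r n)"
      by (simp add: mult_ac)
  qed
qed

text \<open>Suppose \<open>x n\<close> tends to \<open>x0\<close> and \<open>d n = dist (x n) x0\<close> is much smaller than
  \<open>e n = dist (\<phi> (x n)) (\<phi> x0)\<close>.  The values of a Lipschitz function at \<open>\<phi> (x n)\<close> range over balls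
  of radius comparable to \<open>e n\<close> around its value \<open>t *\<^sub>R v\<close> at \<open>\<phi> x0\<close>, whereas the values of its
  preimage at \<open>x n\<close> and \<open>x0\<close> differ by \<open>O(d n)\<close> only.  For a single \<open>t\<close> this is no contradiction.
  But \<open>\<Psi> x0\<close> is injective and \<open>\<Psi> (x n) w\<close> tends to \<open>\<Psi> x0 w\<close>, so along every interval of
  parameters \<open>t\<close> the maps \<open>\<Psi> (x n)\<close> have a displacement bounded below, and for large \<open>n\<close> one of
  the \<open>O(1 / e n)\<close> steps of length \<open>e n\<close> is mapped to a displacement above \<open>n * d n\<close>.
  Such steps are thus dense at every stage, and the Baire category theorem yields one \<open>t\<close> that
  is close to such steps for infinitely many \<open>n\<close>.  One Lipschitz function through the
  ends of these steps then has a preimage that is not Lipschitz.\<close>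

lemma pointwise_lipschitz:
  obtains C where "C > 0" "\<And>x. dist (\<phi> x) (\<phi> x0) \<le> C * dist x x0"
proof (rule ccontr)
  assume "\<not> thesis"
  then have *: "\<And>C. C > 0 \<Longrightarrow> \<exists>x. C * dist x x0 < dist (\<phi> x) (\<phi> x0)"
    using that by (meson not_le)
  \<comment> \<open>The square leaves room for a factor \<open>n\<close>: even \<open>n * d n / e n\<close> will tend to \<open>0\<close>.\<close>
  have "\<exists>x. (real (Suc n))\<^sup>2 * dist x x0 < dist (\<phi> x) (\<phi> x0)" for n
    by (rule *) simp
  then obtain X where X: "\<And>n. (real (Suc n))\<^sup>2 * dist (X n) x0 < dist (\<phi> (X n)) (\<phi> x0)"
    by metis
  obtain D where D: "D > 0" "\<And>y z :: 'y. dist y z \<le> D" using dist_bound by blast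
  have pos: "0 < dist (\<phi> (X n)) (\<phi> x0)" for n
    by (rule le_less_trans[OF _ X]) simp
  have inv0: "(\<lambda>n. c * inverse (real (Suc n))) \<longlonglongrightarrow> 0" for c
    by (rule tendsto_mult_right_zero[OF LIMSEQ_inverse_real_of_nat])
  have "dist (X n) x0 \<le> D * inverse (real (Suc n))" for n
  proof -
    have "real (Suc n) * dist (X n) x0 \<le> (real (Suc n))\<^sup>2 * dist (X n) x0"
      by (intro mult_right_mono) (auto simp: power2_eq_square)
    also have "\<dots> \<le> D" using X[of n] D(2)[of "\<phi> (X n)" "\<phi> x0"] by linarith
    finally show ?thesis by (simp add: field_simps)
  qed
  then have "(\<lambda>n. dist (X n) x0) \<longlonglongrightarrow> 0"
    by (intro tendsto_sandwich[OF _ _ tendsto_const inv0[of D]]) auto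
  then have X_lim: "X \<longlonglongrightarrow> x0" by (simp flip: tendsto_dist_iff)
  then have eX: "(\<lambda>n. dist (\<phi> (X n)) (\<phi> x0)) \<longlonglongrightarrow> 0"
    using tendsto_\<phi> by (simp flip: tendsto_dist_iff)
  have "\<forall>\<^sub>F m in sequentially. dist (\<phi> (X m)) (\<phi> x0) \<le> dist (\<phi> (X n)) (\<phi> x0) / 4" for n
    using order_tendstoD(2)[OF eX, of "dist (\<phi> (X n)) (\<phi> x0) / 4"] pos[of n]
    by (auto elim: eventually_mono)
  from eventually_subsequence[of "\<lambda>n m. dist (\<phi> (X m)) (\<phi> x0) \<le> dist (\<phi> (X n)) (\<phi> x0) / 4", OF this]
  obtain \<sigma> :: "nat \<Rightarrow> nat" where \<sigma>: "strict_mono \<sigma>"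
    and dec: "\<And>i j. i < j \<Longrightarrow> dist (\<phi> (X (\<sigma> j))) (\<phi> x0) \<le> dist (\<phi> (X (\<sigma> i))) (\<phi> x0) / 4"
    by blast
  define x where "x n = X (\<sigma> n)" for n
  define e where "e n = dist (\<phi> (x n)) (\<phi> x0)" for n
  define d where "d n = dist (x n) x0" for n
  have e_pos: "0 < e n" for n unfolding e_def x_def by (rule pos)
  have e_dec: "e j \<le> e i / 4" if "i < j" for i j using dec[OF that] unfolding e_def x_def .
  have x_lim: "x \<longlonglongrightarrow> x0"
    using LIMSEQ_subseq_LIMSEQ[OF X_lim \<sigma>] by (simp add: x_def[abs_def] o_def)
  have e_lim: "e \<longlonglongrightarrow> 0"
    using LIMSEQ_subseq_LIMSEQ[OF eX \<sigma>] by (simp add: e_def[abs_def] x_def o_def)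
  have nd: "real n * d n / e n \<le> 1 * inverse (real (Suc n))" for n
  proof -
    have "real n * d n * real (Suc n) \<le> (real (Suc n))\<^sup>2 * d n"
      by (simp add: power2_eq_square d_def algebra_simps)
    also have "\<dots> \<le> (real (Suc (\<sigma> n)))\<^sup>2 * d n"
      using seq_suble[OF \<sigma>, of n] by (intro mult_right_mono power_mono) (auto simp: d_def)
    also have "\<dots> \<le> e n" using X[of "\<sigma> n"] by (simp add: d_def e_def x_def)
    finally show ?thesis using e_pos[of n] by (simp add: field_simps)
  qed
  have d0: "0 \<le> d n" for n by (simp add: d_def)
  have nde_lim: "(\<lambda>n. real n * d n / e n) \<longlonglongrightarrow> 0"
    by (rule tendsto_sandwich[OF _ _ tendsto_const inv0[of 1]])
       (use nd d0 e_pos in \<open>auto simp: less_imp_le\<close>)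
  have "(\<lambda>n. real n * d n / e n * e n) \<longlonglongrightarrow> 0 * 0"
    by (rule tendsto_mult[OF nde_lim e_lim])
  moreover have "real n * d n / e n * e n = real n * d n" for n using e_pos[of n] by simp
  ultimately have nd_lim: "(\<lambda>n. real n * d n) \<longlonglongrightarrow> 0" by simp

  obtain v :: 'f where v: "v \<noteq> 0" using nontrivial_f by blast
  \<comment> \<open>\<open>U k\<close>: parameters near a step that \<open>\<Psi> (x n)\<close> stretches by more than \<open>n * d n\<close>, for some \<open>n \<ge> k\<close>.\<close>
  define U where "U k = {t::real. \<exists>n\<ge>k. \<exists>s s'. \<bar>s - t\<bar> < e n \<and> \<bar>s' - t\<bar> < e n \<and>
     real n * d n < norm (\<Psi> (x n) (s' *\<^sub>R v) - \<Psi> (x n) (s *\<^sub>R v))}" for k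
  have U_open: "open (U k)" for k
  proof -
    have "U k = (\<Union>(n,s,s')\<in>{(n,s,s'). n \<ge> k \<and>
        real n * d n < norm (\<Psi> (x n) (s' *\<^sub>R v) - \<Psi> (x n) (s *\<^sub>R v))}. ball s (e n) \<inter> ball s' (e n))"
      unfolding U_def by (auto simp: dist_real_def) blast
    then show ?thesis by (auto intro!: open_UN)
  qed
  have U_dense: "UNIV \<subseteq> closure (U k)" for k
  proof
    fix a :: real
    have "\<exists>t\<in>U k. dist t a < \<epsilon>" if \<epsilon>: "\<epsilon> > 0" for \<epsilon>
    proof (rule ccontr)
      assume "\<not> ?thesis"
      then have none: "\<And>t. dist t a < \<epsilon> \<Longrightarrow> t \<notin> U k" by blast
      define b where "b = a + \<epsilon>/2"
      define \<eta> where "\<eta> n = norm (\<Psi> (x n) (b *\<^sub>R v) - \<Psi> (x n) (a *\<^sub>R v))" for n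
      have Psi_lim: "(\<lambda>n. \<Psi> (x n) w) \<longlonglongrightarrow> \<Psi> x0 w" for w
        using Lip_imp_continuous[OF Lip_\<Psi>[OF Lip_const[of w]]] x_lim
        by (rule continuous_on_tendsto_compose) auto
      have \<eta>_lim: "\<eta> \<longlonglongrightarrow> norm (\<Psi> x0 (b *\<^sub>R v) - \<Psi> x0 (a *\<^sub>R v))"
        unfolding \<eta>_def by (intro tendsto_intros Psi_lim)
      have "\<Psi> x0 (b *\<^sub>R v) \<noteq> \<Psi> x0 (a *\<^sub>R v)"
      proof
        assume "\<Psi> x0 (b *\<^sub>R v) = \<Psi> x0 (a *\<^sub>R v)"
        then have "b *\<^sub>R v = a *\<^sub>R v" using \<Phi>_\<Psi>[of "\<phi> x0"] by (metis \<psi>_\<phi>)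
        then show False using v \<epsilon> by (simp add: b_def)
      qed
      then have lim_pos: "0 < norm (\<Psi> x0 (b *\<^sub>R v) - \<Psi> x0 (a *\<^sub>R v))" by simp
      have \<eta>_le: "\<eta> n \<le> \<epsilon> * (real n * d n / e n) + real n * d n" if n: "n \<ge> k" for n
      proof -
        define M where "M = nat \<lceil>\<epsilon> / e n\<rceil>"
        have M: "\<epsilon> / e n \<le> real M" unfolding M_def by (rule real_nat_ceiling_ge)
        have "0 < \<epsilon> / e n" using \<epsilon> e_pos[of n] by simp
        then have M': "real M \<le> \<epsilon> / e n + 1" unfolding M_def by linarith
        have "\<epsilon> / 2 \<le> real M * (e n / 2)" using M e_pos[of n] by (simp add: field_simps)
        then have "norm (b - a) \<le> real M * (e n / 2)" using \<epsilon> by (simp add: b_def)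
        then obtain c c' where c: "c \<in> closed_segment a b" "norm (c' - c) \<le> e n / 2"
          and big: "\<eta> n \<le> real M * norm (\<Psi> (x n) (c' *\<^sub>R v) - \<Psi> (x n) (c *\<^sub>R v))"
          using segment_large_step[of b a M "e n / 2" "\<lambda>t. \<Psi> (x n) (t *\<^sub>R v)"] e_pos[of n]
          unfolding \<eta>_def by (metis half_gt_zero less_imp_le)
        have "dist c a < \<epsilon>"
          using c(1) \<epsilon> by (auto simp: b_def closed_segment_eq_real_ivl dist_real_def)
        then have "c \<notin> U k" by (rule none)
        moreover have "c \<in> U k" if "real n * d n < norm (\<Psi> (x n) (c' *\<^sub>R v) - \<Psi> (x n) (c *\<^sub>R v))"
          unfolding U_def using n c(2) e_pos[of n] that
          by (intro CollectI exI[of _ n] conjI exI[of _ c] exI[of _ c']) auto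
        ultimately have small: "norm (\<Psi> (x n) (c' *\<^sub>R v) - \<Psi> (x n) (c *\<^sub>R v)) \<le> real n * d n"
          by (meson not_le)
        have "\<eta> n \<le> real M * (real n * d n)"
          by (rule order_trans[OF big mult_left_mono[OF small]]) simp
        also have "\<dots> \<le> (\<epsilon> / e n + 1) * (real n * d n)"
          using M' d0[of n] by (intro mult_right_mono) auto
        finally show ?thesis by (simp add: algebra_simps)
      qed
      have "(\<lambda>n. \<epsilon> * (real n * d n / e n) + real n * d n) \<longlonglongrightarrow> \<epsilon> * 0 + 0"
        by (intro tendsto_intros nde_lim nd_lim)
      then have "norm (\<Psi> x0 (b *\<^sub>R v) - \<Psi> x0 (a *\<^sub>R v)) \<le> \<epsilon> * 0 + 0"
        by (rule LIMSEQ_le[OF \<eta>_lim]) (use \<eta>_le in blast)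
      with lim_pos show False by simp
    qed
    then show "a \<in> closure (U k)" by (simp add: closure_approachable)
  qed
  have inter_dense: "UNIV \<subseteq> closure (\<Inter>(range U))"
  proof (rule Baire)
    fix S assume "S \<in> range U"
    then show "openin (top_of_set UNIV) S \<and> UNIV \<subseteq> closure S"
      using U_open U_dense by auto
  qed auto
  have "\<Inter>(range U) \<noteq> {}"
  proof
    assume "\<Inter>(range U) = {}"
    then show False using inter_dense by simp
  qed
  then obtain t where t: "\<And>k. t \<in> U k" by blast

  \<comment> \<open>One end of a large step near \<open>t\<close> is displaced from \<open>\<Psi> x0 (t *\<^sub>R v)\<close> by at least half of it.  For every \<open>n\<close>
    the function below passes through such an end if there is one, and through some nearby point otherwise.\<close>
  define bad where "bad n s \<longleftrightarrow> \<bar>s - t\<bar> < e n \<and>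
    real n / 2 * d n < norm (\<Psi> (x n) (s *\<^sub>R v) - \<Psi> x0 (t *\<^sub>R v))" for n s
  have "\<exists>s. \<bar>s - t\<bar> < e n \<and> ((\<exists>s'. bad n s') \<longrightarrow> bad n s)" for n
  proof (cases "\<exists>s'. bad n s'")
    case True
    then show ?thesis by (auto simp: bad_def)
  next
    case False
    then show ?thesis using e_pos[of n] by (intro exI[of _ t]) auto
  qed
  then obtain s where s: "\<And>n. \<bar>s n - t\<bar> < e n" "\<And>n. \<exists>s'. bad n s' \<Longrightarrow> bad n (s n)" by metis
  have sep: "e i / 4 + e j / 4 \<le> dist (\<phi> (x i)) (\<phi> (x j))" if "i \<noteq> j" for i j
  proof -
    have "e i / 4 + e j / 4 \<le> dist (\<phi> (x i)) (\<phi> (x j))" if "i < j" for i j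
      using e_dec[OF that] e_pos[of i] e_pos[of j] dist_triangle[of "\<phi> (x i)" "\<phi> x0" "\<phi> (x j)"]
      unfolding e_def by linarith
    from this[of i j] this[of j i] that show ?thesis
      by (cases "i < j") (auto simp: dist_commute add.commute)
  qed
  have "norm ((s n - t) *\<^sub>R v) \<le> 4 * norm v * (e n / 4)" for n
    using s(1)[of n] by (simp add: mult.commute mult_left_mono)
  moreover have "0 < e n / 4" for n using e_pos by simp
  ultimately obtain g where g: "g \<in> Lip" "\<And>n. g (\<phi> (x n)) = (s n - t) *\<^sub>R v"
    and "\<And>y. (\<And>n. e n / 4 \<le> dist y (\<phi> (x n))) \<Longrightarrow> g y = 0"
    using disjoint_bumps[where p="\<lambda>n. \<phi> (x n)", OF sep, where a="\<lambda>n. (s n - t) *\<^sub>R v"] by blast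
  moreover have "e n / 4 \<le> dist (\<phi> x0) (\<phi> (x n))" for n
    using e_pos[of n] by (simp add: e_def dist_commute)
  ultimately have g0: "g (\<phi> x0) = 0" by blast
  have "(\<lambda>x. \<Psi> x (t *\<^sub>R v + g (\<phi> x))) \<in> Lip"
    using Lip_\<Psi>[OF Lip_add[OF Lip_const g(1)]] by simp
  from LipD[OF this]
  obtain L where L: "\<And>x y. dist (\<Psi> x (t *\<^sub>R v + g (\<phi> x))) (\<Psi> y (t *\<^sub>R v + g (\<phi> y))) \<le> L * dist x y"
    by blast
  have bound: "norm (\<Psi> (x n) (s n *\<^sub>R v) - \<Psi> x0 (t *\<^sub>R v)) \<le> L * d n" for n
    using L[of "x n" x0] g g0 by (simp add: dist_norm d_def algebra_simps)
  obtain k :: nat where k: "2 * L \<le> real k" using real_arch_simple by blast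
  obtain n s1 s2 where n: "n \<ge> k" and s12: "\<bar>s1 - t\<bar> < e n" "\<bar>s2 - t\<bar> < e n"
    "real n * d n < norm (\<Psi> (x n) (s2 *\<^sub>R v) - \<Psi> (x n) (s1 *\<^sub>R v))"
    using t[of k] unfolding U_def by blast
  have "norm (\<Psi> (x n) (s2 *\<^sub>R v) - \<Psi> (x n) (s1 *\<^sub>R v))
      \<le> norm (\<Psi> (x n) (s2 *\<^sub>R v) - \<Psi> x0 (t *\<^sub>R v)) + norm (\<Psi> (x n) (s1 *\<^sub>R v) - \<Psi> x0 (t *\<^sub>R v))"
    using norm_triangle_ineq4[of "\<Psi> (x n) (s2 *\<^sub>R v) - \<Psi> x0 (t *\<^sub>R v)" "\<Psi> (x n) (s1 *\<^sub>R v) - \<Psi> x0 (t *\<^sub>R v)"] by simp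
  then have "bad n s1 \<or> bad n s2" using s12 unfolding bad_def by argo
  then have "bad n (s n)" using s(2) by blast
  then have "real n / 2 * d n < L * d n" using bound[of n] unfolding bad_def by linarith
  moreover have "L * d n \<le> real n / 2 * d n" using k n d0[of n] by (intro mult_right_mono) auto
  ultimately show False by simp
qed

section \<open>Excluding pairs with unbounded stretching\<close>

text \<open>Let \<open>\<rho> n\<close> be the distance from \<open>\<phi> (x n)\<close> to \<open>\<phi> x0\<close> and \<open>e n\<close> the distance from \<open>\<phi> (x n)\<close> to
  \<open>\<phi> (x' n)\<close>.  After thinning, balls of radius \<open>\<rho> n / 4\<close> around the points \<open>\<phi> (x n)\<close> are disjoint,
  and \<open>fibre_displacement\<close> bounds the displacement of \<open>\<Psi> (x n)\<close> on balls of radius \<open>O(\<rho> n)\<close> by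
  \<open>O(\<rho> n * dist (x n) (x' n) / e n)\<close>, which is \<open>o(\<rho> n)\<close>.  On the other hand the images of the
  constant \<open>0\<close> and of \<open>\<lambda>x. dist x x0 *\<^sub>R w\<close> take values at \<open>\<phi> (x n)\<close> in such a ball, and their
  preimages at \<open>x n\<close> are \<open>dist (x n) x0 * norm w\<close> apart, which is at least a constant multiple of
  \<open>\<rho> n\<close> by \<open>pointwise_lipschitz\<close>.\<close>

lemma no_convergent_pairs_aux:
  fixes x x' :: "nat \<Rightarrow> 'x"
  assumes x: "x \<longlonglongrightarrow> x0"
    and ne: "\<And>n. \<phi> (x n) \<noteq> \<phi> (x' n)"
    and lim: "(\<lambda>n. dist (x n) (x' n) / dist (\<phi> (x n)) (\<phi> (x' n))) \<longlonglongrightarrow> 0"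
    and closer: "\<And>n. dist (\<phi> (x' n)) (\<phi> x0) \<le> dist (\<phi> (x n)) (\<phi> x0)"
  shows False
proof -
  define \<rho>0 where "\<rho>0 n = dist (\<phi> (x n)) (\<phi> x0)" for n
  have \<rho>0_lim: "\<rho>0 \<longlonglongrightarrow> 0"
    using tendsto_\<phi>[OF x] by (simp add: \<rho>0_def[abs_def] flip: tendsto_dist_iff)
  have \<rho>0_pos: "0 < \<rho>0 n" for n
  proof -
    have "\<phi> (x n) \<noteq> \<phi> x0" using ne[of n] closer[of n] by (metis dist_le_zero_iff dist_self)
    then show ?thesis by (simp add: \<rho>0_def)
  qed
  \<comment> \<open>The second clause keeps \<open>\<phi> (x' n)\<close> out of the later balls; if \<open>\<phi> (x' n) = \<phi> x0\<close> it lies outside all of them.\<close>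
  let ?P = "\<lambda>n m. \<rho>0 m \<le> \<rho>0 n / 4 \<and> (\<phi> (x' n) = \<phi> x0 \<or> 2 * \<rho>0 m \<le> dist (\<phi> (x' n)) (\<phi> x0))"
  have "eventually (?P n) sequentially" for n
  proof -
    have "\<forall>\<^sub>F m in sequentially. \<rho>0 m < \<rho>0 n / 4"
      using order_tendstoD(2)[OF \<rho>0_lim, of "\<rho>0 n / 4"] \<rho>0_pos[of n] by simp
    moreover have "\<forall>\<^sub>F m in sequentially. \<phi> (x' n) = \<phi> x0 \<or> 2 * \<rho>0 m \<le> dist (\<phi> (x' n)) (\<phi> x0)"
    proof (cases "\<phi> (x' n) = \<phi> x0")
      case False
      then have "\<forall>\<^sub>F m in sequentially. \<rho>0 m < dist (\<phi> (x' n)) (\<phi> x0) / 2"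
        using order_tendstoD(2)[OF \<rho>0_lim, of "dist (\<phi> (x' n)) (\<phi> x0) / 2"] by simp
      then show ?thesis by eventually_elim simp
    qed simp
    ultimately show ?thesis by eventually_elim auto
  qed
  from eventually_subsequence[of ?P, OF this]
  obtain \<sigma> :: "nat \<Rightarrow> nat" where \<sigma>: "strict_mono \<sigma>"
    and P: "\<And>i j. i < j \<Longrightarrow> ?P (\<sigma> i) (\<sigma> j)"
    by blast
  define z where "z n = x (\<sigma> n)" for n
  define z' where "z' n = x' (\<sigma> n)" for n
  define \<rho> where "\<rho> n = dist (\<phi> (z n)) (\<phi> x0)" for n
  define e where "e n = dist (\<phi> (z n)) (\<phi> (z' n))" for n
  define r where "r n = min (e n) (\<rho> n / 4)" for n
  have \<rho>_pos: "0 < \<rho> n" for n using \<rho>0_pos[of "\<sigma> n"] by (simp add: \<rho>_def \<rho>0_def z_def)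
  have e_pos: "0 < e n" for n using ne[of "\<sigma> n"] by (simp add: e_def z_def z'_def)
  have z': "dist (\<phi> (z' n)) (\<phi> x0) \<le> \<rho> n" for n
    using closer[of "\<sigma> n"] by (simp add: \<rho>_def z_def z'_def)
  have P': "\<rho> j \<le> \<rho> i / 4" "\<phi> (z' i) = \<phi> x0 \<or> 2 * \<rho> j \<le> dist (\<phi> (z' i)) (\<phi> x0)"
    if "i < j" for i j
    using P[OF that] by (simp_all add: \<rho>_def \<rho>0_def z_def z'_def)
  have e_le: "e n \<le> 2 * \<rho> n" for n
    using dist_triangle2[of "\<phi> (z n)" "\<phi> (z' n)" "\<phi> x0"] z'[of n] by (simp add: e_def \<rho>_def)
  have r_ge: "e n / 8 \<le> r n" for n using e_le[of n] e_pos[of n] by (simp add: r_def)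
  have r_pos: "0 < r n" for n using r_ge[of n] e_pos[of n] by linarith
  have sep: "\<rho> i / 4 + \<rho> j / 4 \<le> dist (\<phi> (z i)) (\<phi> (z j))" if "i \<noteq> j" for i j
  proof -
    have "\<rho> i / 4 + \<rho> j / 4 \<le> dist (\<phi> (z i)) (\<phi> (z j))" if "i < j" for i j
      using P'(1)[OF that] \<rho>_pos[of i] \<rho>_pos[of j] dist_triangle[of "\<phi> (z i)" "\<phi> x0" "\<phi> (z j)"]
      unfolding \<rho>_def by linarith
    from this[of i j] this[of j i] that show ?thesis
      by (cases "i < j") (auto simp: dist_commute add.commute)
  qed
  have away: "r m \<le> dist (\<phi> (z' n)) (\<phi> (z m))" for n m
  proof (cases n m rule: linorder_cases)
    case less
    from P'(2)[OF this] have "\<rho> m / 4 \<le> dist (\<phi> (z' n)) (\<phi> (z m))"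
    proof
      assume "\<phi> (z' n) = \<phi> x0"
      then show ?thesis using \<rho>_pos[of m] by (simp add: \<rho>_def dist_commute)
    next
      assume "2 * \<rho> m \<le> dist (\<phi> (z' n)) (\<phi> x0)"
      then show ?thesis
        using \<rho>_pos[of m] dist_triangle[of "\<phi> (z' n)" "\<phi> x0" "\<phi> (z m)"] unfolding \<rho>_def by linarith
    qed
    then show ?thesis by (simp add: r_def)
  next
    case equal
    then show ?thesis by (simp add: r_def e_def dist_commute)
  next
    case greater
    have "\<rho> m / 4 \<le> dist (\<phi> (z' n)) (\<phi> (z m))"
      using P'(1)[OF greater] z'[of n] \<rho>_pos[of m] dist_triangle[of "\<phi> (z m)" "\<phi> x0" "\<phi> (z' n)"]
        dist_commute[of "\<phi> (z m)" "\<phi> (z' n)"]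
      unfolding \<rho>_def by linarith
    then show ?thesis by (simp add: r_def)
  qed
  obtain w :: 'e where w: "w \<noteq> 0" using nontrivial_e by blast
  obtain C where C: "C > 0" "\<And>x. dist (\<phi> x) (\<phi> x0) \<le> C * dist x x0"
    using pointwise_lipschitz[of x0] by blast
  define v where "v = \<Phi> (\<phi> x0) 0"
  define b0 where "b0 n = \<Phi> (\<phi> (z n)) 0" for n
  define b1 where "b1 n = \<Phi> (\<phi> (z n)) (dist (z n) x0 *\<^sub>R w)" for n
  obtain K0 where K0: "\<And>y z. dist (\<Phi> y 0) (\<Phi> z 0) \<le> K0 * dist y z"
    using LipD[OF Lip_\<Phi>[OF Lip_const[of 0]]] by blast
  obtain K1 where K1: "\<And>y z. dist (\<Phi> y (dist (\<psi> y) x0 *\<^sub>R w)) (\<Phi> z (dist (\<psi> z) x0 *\<^sub>R w)) \<le> K1 * dist y z"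
    using LipD[OF Lip_\<Phi>[OF Lip_dist_scaleR[of x0 w]]] by blast
  define K where "K = 4 * max K0 K1"
  have "norm (b0 n - v) \<le> K0 * \<rho> n" for n
    using K0[of "\<phi> (z n)" "\<phi> x0"] by (simp add: b0_def v_def \<rho>_def dist_norm)
  moreover have "norm (b1 n - v) \<le> K1 * \<rho> n" for n
    using K1[of "\<phi> (z n)" "\<phi> x0"] by (simp add: b1_def v_def \<rho>_def dist_norm \<psi>_\<phi>)
  moreover have "K0 * \<rho> n \<le> K * (\<rho> n / 4)" "K1 * \<rho> n \<le> K * (\<rho> n / 4)" for n
    using \<rho>_pos[of n] by (simp_all add: K_def)
  ultimately have b: "\<And>n. norm (b0 n - v) \<le> K * (\<rho> n / 4)" "\<And>n. norm (b1 n - v) \<le> K * (\<rho> n / 4)"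
    by (meson order_trans)+
  have r_le: "r n \<le> \<rho> n / 4" for n by (simp add: r_def)
  from fibre_displacement[where x=z and x'=z' and R="\<lambda>n. \<rho> n / 4", OF sep r_pos r_le away b]
  obtain L where L: "0 \<le> L"
    "\<And>n. norm (\<Psi> (z n) (b1 n) - \<Psi> (z n) (b0 n)) \<le> L * dist (z n) (z' n) * (\<rho> n / 4 / r n)"
    by blast
  have key: "norm w / C \<le> 2 * L * (dist (z n) (z' n) / e n)" for n
  proof -
    have "\<rho> n * norm w \<le> C * (dist (z n) x0 * norm w)"
      using mult_right_mono[OF C(2)[of "z n"], of "norm w"] by (simp add: \<rho>_def mult.assoc)
    also have "dist (z n) x0 * norm w = norm (\<Psi> (z n) (b1 n) - \<Psi> (z n) (b0 n))"
      by (simp add: b0_def b1_def \<Psi>_\<Phi>)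
    also have "\<dots> \<le> L * dist (z n) (z' n) * (\<rho> n / 4 / r n)" by (rule L(2))
    also have "\<dots> \<le> L * dist (z n) (z' n) * (\<rho> n / 4 / (e n / 8))"
      using L(1) r_ge[of n] e_pos[of n] r_pos[of n] \<rho>_pos[of n]
      by (intro mult_left_mono divide_left_mono) auto
    finally have "\<rho> n * (norm w / C) \<le> \<rho> n * (2 * L * (dist (z n) (z' n) / e n))"
      using C(1) by (simp add: field_simps)
    then show ?thesis using \<rho>_pos[of n] by (rule mult_left_le_imp_le)
  qed
  have "(\<lambda>n. dist (z n) (z' n) / e n) \<longlonglongrightarrow> 0"
    using LIMSEQ_subseq_LIMSEQ[OF lim \<sigma>] by (simp add: z_def z'_def e_def o_def)
  then have "(\<lambda>n. 2 * L * (dist (z n) (z' n) / e n)) \<longlonglongrightarrow> 2 * L * 0"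
    by (intro tendsto_intros)
  then have "norm w / C \<le> 2 * L * 0"
    by (rule LIMSEQ_le_const) (use key in blast)
  then show False using w C(1) by (simp add: divide_le_0_iff)
qed

text \<open>The two members of a pair enter symmetrically, so the one with the more distant image can be
  taken first.\<close>

lemma no_convergent_pairs:
  fixes x x' :: "nat \<Rightarrow> 'x"
  assumes x: "x \<longlonglongrightarrow> x0" and x': "x' \<longlonglongrightarrow> x0"
    and ne: "\<And>n. \<phi> (x n) \<noteq> \<phi> (x' n)"
    and lim: "(\<lambda>n. dist (x n) (x' n) / dist (\<phi> (x n)) (\<phi> (x' n))) \<longlonglongrightarrow> 0"
  shows False
proof -
  define A where "A n \<longleftrightarrow> dist (\<phi> (x' n)) (\<phi> x0) \<le> dist (\<phi> (x n)) (\<phi> x0)" for n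
  define z where "z n = (if A n then x n else x' n)" for n
  define z' where "z' n = (if A n then x' n else x n)" for n
  have le: "dist (z n) x0 \<le> dist (x n) x0 + dist (x' n) x0" for n by (simp add: z_def)
  have sum: "(\<lambda>n. dist (x n) x0 + dist (x' n) x0) \<longlonglongrightarrow> 0"
    using tendsto_add[OF iffD1[OF tendsto_dist_iff x] iffD1[OF tendsto_dist_iff x']] by simp
  have "(\<lambda>n. dist (z n) x0) \<longlonglongrightarrow> 0"
    by (rule tendsto_sandwich[OF _ _ tendsto_const sum]) (use le in auto)
  then have "z \<longlonglongrightarrow> x0" by (simp flip: tendsto_dist_iff)
  then show False
  proof (rule no_convergent_pairs_aux)
    show "\<phi> (z n) \<noteq> \<phi> (z' n)" for n using ne[of n] by (auto simp: z_def z'_def)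
    show "dist (\<phi> (z' n)) (\<phi> x0) \<le> dist (\<phi> (z n)) (\<phi> x0)" for n by (auto simp: z_def z'_def A_def)
    have "dist (z n) (z' n) / dist (\<phi> (z n)) (\<phi> (z' n)) = dist (x n) (x' n) / dist (\<phi> (x n)) (\<phi> (x' n))" for n
      by (simp add: z_def z'_def dist_commute)
    then show "(\<lambda>n. dist (z n) (z' n) / dist (\<phi> (z n)) (\<phi> (z' n))) \<longlonglongrightarrow> 0" using lim by simp
  qed
qed

text \<open>Here the balls around the points \<open>\<phi> (x n)\<close> can be given a fixed radius \<open>\<delta>\<close>.  The displacement of
  \<open>\<Psi> (x n)\<close> on any bounded set then tends to \<open>0\<close>.  But the images of the constants \<open>0\<close> and \<open>w\<close> are
  bounded, since the codomain is, and their preimages stay at distance \<open>norm w\<close>.\<close>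

lemma no_separated_pairs:
  fixes x x' :: "nat \<Rightarrow> 'x"
  assumes \<epsilon>: "0 < \<epsilon>"
    and sep: "\<And>i j. i < j \<Longrightarrow> \<epsilon> \<le> dist (\<phi> (x i)) (\<phi> (x j))"
    and sep': "\<And>i j. i < j \<Longrightarrow> \<epsilon> \<le> dist (\<phi> (x' i)) (\<phi> (x' j))"
    and ne: "\<And>n. \<phi> (x n) \<noteq> \<phi> (x' n)"
    and lim0: "(\<lambda>n. dist (x n) (x' n)) \<longlonglongrightarrow> 0"
    and lim: "(\<lambda>n. dist (x n) (x' n) / dist (\<phi> (x n)) (\<phi> (x' n))) \<longlonglongrightarrow> 0"
  shows False
proof -
  let ?P = "\<lambda>n m. \<epsilon>/2 \<le> dist (\<phi> (x m)) (\<phi> (x' n)) \<and> \<epsilon>/2 \<le> dist (\<phi> (x' m)) (\<phi> (x n))"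
  have "eventually (?P n) sequentially" for n
    using separated_eventually_away[of \<epsilon> "\<lambda>n. \<phi> (x n)" "\<phi> (x' n)"] sep
      separated_eventually_away[of \<epsilon> "\<lambda>n. \<phi> (x' n)" "\<phi> (x n)"] sep'
    by (simp add: eventually_conj_iff)
  from eventually_subsequence[of ?P, OF this]
  obtain \<sigma> :: "nat \<Rightarrow> nat" where \<sigma>: "strict_mono \<sigma>"
    and P: "\<And>i j. i < j \<Longrightarrow> ?P (\<sigma> i) (\<sigma> j)"
    by blast
  define z where "z n = x (\<sigma> n)" for n
  define z' where "z' n = x' (\<sigma> n)" for n
  define e where "e n = dist (\<phi> (z n)) (\<phi> (z' n))" for n
  define \<delta> where "\<delta> = \<epsilon>/2"
  have \<delta>: "0 < \<delta>" using \<epsilon> by (simp add: \<delta>_def)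
  define r where "r n = min (e n) \<delta>" for n
  have e_pos: "0 < e n" for n using ne[of "\<sigma> n"] by (simp add: e_def z_def z'_def)
  have r_pos: "0 < r n" for n using e_pos[of n] \<delta> by (simp add: r_def)
  have r_le: "r n \<le> \<delta>" for n by (simp add: r_def)
  have sep_z: "\<delta> + \<delta> \<le> dist (\<phi> (z i)) (\<phi> (z j))" if "i \<noteq> j" for i j
  proof (cases "i < j")
    case True
    then show ?thesis using sep[of "\<sigma> i" "\<sigma> j"] \<sigma> by (simp add: \<delta>_def z_def strict_mono_less)
  next
    case False
    with that show ?thesis using sep[of "\<sigma> j" "\<sigma> i"] \<sigma>
      by (simp add: \<delta>_def z_def strict_mono_less dist_commute)
  qed
  have away: "r m \<le> dist (\<phi> (z' n)) (\<phi> (z m))" for n m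
  proof (cases n m rule: linorder_cases)
    case less
    then show ?thesis using P[OF less] by (simp add: z_def z'_def r_def \<delta>_def dist_commute min_le_iff_disj)
  next
    case equal
    then show ?thesis by (simp add: r_def e_def dist_commute)
  next
    case greater
    then show ?thesis using P[OF greater] by (simp add: z_def z'_def r_def \<delta>_def dist_commute min_le_iff_disj)
  qed
  obtain w :: 'e where w: "w \<noteq> 0" using nontrivial_e by blast
  have "\<exists>B. \<forall>y. norm (\<Phi> y u) \<le> B" for u
  proof -
    obtain D where D: "\<And>y z :: 'y. dist y z \<le> D" using dist_bound by blast
    obtain K where K: "0 \<le> K" "\<And>y z. dist (\<Phi> y u) (\<Phi> z u) \<le> K * dist y z"
      using LipD[OF Lip_\<Phi>[OF Lip_const[of u]]] by blast
    fix y0 :: 'y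
    have "norm (\<Phi> y u) \<le> norm (\<Phi> y0 u) + K * D" for y
    proof -
      have "norm (\<Phi> y u) \<le> norm (\<Phi> y0 u) + dist (\<Phi> y u) (\<Phi> y0 u)"
        using norm_triangle_sub[of "\<Phi> y u" "\<Phi> y0 u"] by (simp add: dist_norm)
      also have "dist (\<Phi> y u) (\<Phi> y0 u) \<le> K * D"
        by (rule order_trans[OF K(2) mult_left_mono[OF D K(1)]])
      finally show ?thesis by simp
    qed
    then show ?thesis by blast
  qed
  then obtain B where B: "\<And>u y. norm (\<Phi> y u) \<le> B u" by metis
  define K where "K = max (B 0) (B w) / \<delta>"
  have b: "norm (\<Phi> (\<phi> (z n)) 0 - 0) \<le> K * \<delta>" "norm (\<Phi> (\<phi> (z n)) w - 0) \<le> K * \<delta>" for n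
    using B[of "\<phi> (z n)" 0] B[of "\<phi> (z n)" w] \<delta> by (simp_all add: K_def le_max_iff_disj)
  from fibre_displacement[where x=z and x'=z' and R="\<lambda>_. \<delta>" and v=0
      and a="\<lambda>n. \<Phi> (\<phi> (z n)) 0" and b="\<lambda>n. \<Phi> (\<phi> (z n)) w", OF sep_z r_pos r_le away b]
  obtain L where L: "0 \<le> L"
    "\<And>n. norm (\<Psi> (z n) (\<Phi> (\<phi> (z n)) w) - \<Psi> (z n) (\<Phi> (\<phi> (z n)) 0)) \<le> L * dist (z n) (z' n) * (\<delta> / r n)"
    by blast
  have key: "norm w \<le> L * \<delta> * (dist (z n) (z' n) / e n + dist (z n) (z' n) / \<delta>)" for n
  proof -
    have "norm w \<le> L * \<delta> * (dist (z n) (z' n) / r n)" using L(2)[of n] by (simp add: \<Psi>_\<Phi> mult_ac)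
    also have "dist (z n) (z' n) / r n \<le> dist (z n) (z' n) / e n + dist (z n) (z' n) / \<delta>"
      using e_pos[of n] \<delta> by (simp add: r_def min_def)
    finally show ?thesis using L(1) \<delta> by (simp add: mult_left_mono)
  qed
  have "(\<lambda>n. dist (z n) (z' n)) \<longlonglongrightarrow> 0"
    using LIMSEQ_subseq_LIMSEQ[OF lim0 \<sigma>] by (simp add: z_def z'_def o_def)
  moreover have "(\<lambda>n. dist (z n) (z' n) / e n) \<longlonglongrightarrow> 0"
    using LIMSEQ_subseq_LIMSEQ[OF lim \<sigma>] by (simp add: z_def z'_def e_def o_def)
  ultimately have "(\<lambda>n. L * \<delta> * (dist (z n) (z' n) / e n + dist (z n) (z' n) / \<delta>)) \<longlonglongrightarrow> L * \<delta> * (0 + 0 / \<delta>)"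
    using \<delta> by (intro tendsto_intros) auto
  then have "norm w \<le> L * \<delta> * (0 + 0 / \<delta>)"
    by (rule LIMSEQ_le_const) (use key in blast)
  then show False using w by simp
qed

text \<open>Boundedness of the codomain forces the two points of badly stretched pairs together.  If the
  images of either coordinate had a limit along a subsequence, continuity of \<open>\<psi>\<close> would make both
  points of the pairs converge to the same point, against \<open>no_convergent_pairs\<close>; otherwise
  completeness makes both image sequences separated along a subsequence, against
  \<open>no_separated_pairs\<close>.\<close>

lemma Lip_homeomorphism: "\<phi> \<in> Lip"
proof (rule ccontr)
  assume "\<phi> \<notin> Lip"
  have "\<exists>x x'. real (Suc n) * dist x x' < dist (\<phi> x) (\<phi> x')" for n
  proof (rule ccontr)
    assume "\<not> ?thesis"
    then have "dist (\<phi> x) (\<phi> x') \<le> real (Suc n) * dist x x'" for x x'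
      by (meson not_le)
    then have "(real (Suc n))-lipschitz_on UNIV \<phi>"
      by (rule lipschitz_onI) simp
    then show False using \<open>\<phi> \<notin> Lip\<close> LipI by blast
  qed
  then obtain x x' where X: "\<And>n. real (Suc n) * dist (x n) (x' n) < dist (\<phi> (x n)) (\<phi> (x' n))"
    by metis
  have pos: "0 < dist (\<phi> (x n)) (\<phi> (x' n))" for n by (rule le_less_trans[OF _ X]) simp
  then have ne: "\<phi> (x n) \<noteq> \<phi> (x' n)" for n using zero_less_dist_iff by blast
  obtain D where D: "D > 0" "\<And>y z :: 'y. dist y z \<le> D" using dist_bound by blast
  have inv0: "(\<lambda>n. c * inverse (real (Suc n))) \<longlonglongrightarrow> 0" for c
    by (rule tendsto_mult_right_zero[OF LIMSEQ_inverse_real_of_nat])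
  have "dist (x n) (x' n) / dist (\<phi> (x n)) (\<phi> (x' n)) \<le> 1 * inverse (real (Suc n))" for n
    using X[of n] pos[of n] by (simp add: field_simps del: of_nat_Suc)
  then have lim: "(\<lambda>n. dist (x n) (x' n) / dist (\<phi> (x n)) (\<phi> (x' n))) \<longlonglongrightarrow> 0"
    by (intro tendsto_sandwich[OF _ _ tendsto_const inv0[of 1]]) auto
  have "dist (x n) (x' n) \<le> D * inverse (real (Suc n))" for n
    using X[of n] D(2)[of "\<phi> (x n)" "\<phi> (x' n)"] by (simp add: field_simps del: of_nat_Suc)
  then have lim0: "(\<lambda>n. dist (x n) (x' n)) \<longlonglongrightarrow> 0"
    by (intro tendsto_sandwich[OF _ _ tendsto_const inv0[of D]]) auto
  have no_limit: False
    if \<sigma>: "strict_mono \<sigma>" and l: "(\<lambda>n. \<phi> (x (\<sigma> n))) \<longlonglongrightarrow> l \<or> (\<lambda>n. \<phi> (x' (\<sigma> n))) \<longlonglongrightarrow> l"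
    for \<sigma> :: "nat \<Rightarrow> nat" and l
  proof -
    have d: "(\<lambda>n. dist (x (\<sigma> n)) (x' (\<sigma> n))) \<longlonglongrightarrow> 0"
      using LIMSEQ_subseq_LIMSEQ[OF lim0 \<sigma>] by (simp add: o_def)
    have q: "(\<lambda>n. dist (x (\<sigma> n)) (x' (\<sigma> n)) / dist (\<phi> (x (\<sigma> n))) (\<phi> (x' (\<sigma> n)))) \<longlonglongrightarrow> 0"
      using LIMSEQ_subseq_LIMSEQ[OF lim \<sigma>] by (simp add: o_def)
    have transfer: "b \<longlonglongrightarrow> m" if "a \<longlonglongrightarrow> m" "(\<lambda>n. dist (a n) (b n)) \<longlonglongrightarrow> 0" for a b :: "nat \<Rightarrow> 'x" and m
    proof -
      have sum: "(\<lambda>n. dist (a n) (b n) + dist (a n) m) \<longlonglongrightarrow> 0"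
        using tendsto_add[OF that(2) iffD1[OF tendsto_dist_iff that(1)]] by simp
      have le: "dist (b n) m \<le> dist (a n) (b n) + dist (a n) m" for n
        by (rule dist_triangle3)
      have "(\<lambda>n. dist (b n) m) \<longlonglongrightarrow> 0"
        by (rule tendsto_sandwich[OF _ _ tendsto_const sum]) (use le in auto)
      then show ?thesis by (simp flip: tendsto_dist_iff)
    qed
    have "(\<lambda>n. x (\<sigma> n)) \<longlonglongrightarrow> \<psi> l \<or> (\<lambda>n. x' (\<sigma> n)) \<longlonglongrightarrow> \<psi> l"
      using l tendsto_\<psi>[of "\<lambda>n. \<phi> (x (\<sigma> n))" l] tendsto_\<psi>[of "\<lambda>n. \<phi> (x' (\<sigma> n))" l]
      by (auto simp: \<psi>_\<phi>)
    then have "(\<lambda>n. x (\<sigma> n)) \<longlonglongrightarrow> \<psi> l" "(\<lambda>n. x' (\<sigma> n)) \<longlonglongrightarrow> \<psi> l"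
      using transfer[of "\<lambda>n. x (\<sigma> n)" "\<psi> l" "\<lambda>n. x' (\<sigma> n)"]
        transfer[of "\<lambda>n. x' (\<sigma> n)" "\<psi> l" "\<lambda>n. x (\<sigma> n)"] d
      by (auto simp: dist_commute)
    then show False using ne q by (rule no_convergent_pairs)
  qed
  show False
  proof (cases "\<lambda>n. \<phi> (x n)" rule: convergent_or_separated_subsequence)
    case (convergent \<sigma> l)
    then show False using no_limit[of \<sigma> l] by (simp add: o_def)
  next
    case sep1: (separated \<sigma> \<epsilon>)
    show False
    proof (cases "\<lambda>n. \<phi> (x' (\<sigma> n))" rule: convergent_or_separated_subsequence)
      case (convergent \<tau> l)
      then show False using no_limit[OF strict_mono_o[OF sep1(1)], of \<tau> l] by (simp add: o_def)
    next
      case sep2: (separated \<tau> \<epsilon>')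
      have \<sigma>\<tau>: "strict_mono (\<sigma> \<circ> \<tau>)" using sep1(1) sep2(1) by (rule strict_mono_o)
      show False
      proof (rule no_separated_pairs[of "min \<epsilon> \<epsilon>'" "x \<circ> (\<sigma> \<circ> \<tau>)" "x' \<circ> (\<sigma> \<circ> \<tau>)"])
        show "0 < min \<epsilon> \<epsilon>'" using sep1(2) sep2(2) by simp
        show "min \<epsilon> \<epsilon>' \<le> dist (\<phi> ((x \<circ> (\<sigma> \<circ> \<tau>)) i)) (\<phi> ((x \<circ> (\<sigma> \<circ> \<tau>)) j))" if "i < j" for i j
          using sep1(3)[of "\<tau> i" "\<tau> j"] that sep2(1) by (simp add: strict_mono_less min.coboundedI1)
        show "min \<epsilon> \<epsilon>' \<le> dist (\<phi> ((x' \<circ> (\<sigma> \<circ> \<tau>)) i)) (\<phi> ((x' \<circ> (\<sigma> \<circ> \<tau>)) j))" if "i < j" for i j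
          using sep2(3)[OF that] by (simp add: min.coboundedI2)
        show "(\<lambda>n. dist ((x \<circ> (\<sigma> \<circ> \<tau>)) n) ((x' \<circ> (\<sigma> \<circ> \<tau>)) n)) \<longlonglongrightarrow> 0"
          using LIMSEQ_subseq_LIMSEQ[OF lim0 \<sigma>\<tau>] by (simp add: o_def)
        show "(\<lambda>n. dist ((x \<circ> (\<sigma> \<circ> \<tau>)) n) ((x' \<circ> (\<sigma> \<circ> \<tau>)) n)
              / dist (\<phi> ((x \<circ> (\<sigma> \<circ> \<tau>)) n)) (\<phi> ((x' \<circ> (\<sigma> \<circ> \<tau>)) n))) \<longlonglongrightarrow> 0"
          using LIMSEQ_subseq_LIMSEQ[OF lim \<sigma>\<tau>] by (simp add: o_def)
      qed (simp add: ne)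
    qed
  qed
qed

end

section \<open>Biseparating maps\<close>

theorem theorem8p5:
  fixes T :: "('x::complete_space \<Rightarrow> 'e::banach) \<Rightarrow> ('y::complete_space \<Rightarrow> 'f::banach)"
    and \<phi> :: "'x \<Rightarrow> 'y"
    and \<Phi> :: "'y \<times> 'e \<Rightarrow> 'f"
  assumes "bounded (UNIV :: 'x set)"
    and "bounded (UNIV :: 'y set)"
    and "\<exists>u::'e. u \<noteq> 0"
    and "\<exists>v::'f. v \<noteq> 0"
    and "biseparating Lip Lip T"
    and "homeomorphism UNIV UNIV \<phi> (inv \<phi>)"
    and "\<And>y. bij (\<lambda>u. \<Phi> (y, u))"
    and "\<And>f y. f \<in> Lip \<Longrightarrow> T f y = \<Phi> (y, f (inv \<phi> y))"
  shows "lipschitz_homeomorphism \<phi>"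
proof -
  note bounded = assms(1,2) and nontrivial = assms(3,4) and homeo = assms(6)
    and bij = assms(7) and T_eq = assms(8)
  define F where "F y u = \<Phi> (y, u)" for y u
  define G where "G x = inv (F (\<phi> x))" for x
  have bij_F: "bij (F y)" for y using bij[of y] by (simp add: F_def[abs_def])
  have inv1: "inv \<phi> (\<phi> x) = x" and inv2: "\<phi> (inv \<phi> y) = y" for x y
    using homeo by (simp_all add: homeomorphism_def)
  have cont: "continuous_on UNIV \<phi>" "continuous_on UNIV (inv \<phi>)"
    using homeo by (simp_all add: homeomorphism_def)
  have G_F: "G x (F (\<phi> x) u) = u" for x u
    using bij_F by (simp add: G_def bij_is_inj inv_f_f)
  have F_G: "F (\<phi> x) (G x v) = v" for x v
    using bij_F by (simp add: G_def bij_is_surj surj_f_inv_f)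
  have T_bij: "bij_betw T Lip Lip" using assms(5) by (simp add: biseparating_def)
  have T_F: "T f = (\<lambda>y. F y (f (inv \<phi> y)))" if "f \<in> Lip" for f
    using T_eq[OF that] by (auto simp: F_def)
  have Lip_F: "(\<lambda>y. F y (f (inv \<phi> y))) \<in> Lip" if "f \<in> Lip" for f
    using bij_betwE[OF T_bij] that T_F by metis
  have Lip_G: "(\<lambda>x. G x (g (\<phi> x))) \<in> Lip" if g: "g \<in> Lip" for g
  proof -
    obtain f where f: "f \<in> Lip" "g = T f" using T_bij g by (auto simp: bij_betw_def)
    then have "(\<lambda>x. G x (g (\<phi> x))) = f" by (auto simp: T_F inv1 G_F)
    then show ?thesis using f by simp
  qed
  have F_G': "F y (G (inv \<phi> y) v) = v" for y v using F_G[of "inv \<phi> y"] by (simp add: inv2)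
  interpret forward: weighted_composition \<phi> "inv \<phi>" F G
    by unfold_locales
       (use inv1 inv2 cont G_F F_G' Lip_F Lip_G bounded nontrivial in auto)
  interpret backward: weighted_composition "inv \<phi>" \<phi> G F
    by unfold_locales
       (use inv1 inv2 cont G_F F_G' Lip_F Lip_G bounded nontrivial in auto)
  have "bij \<phi>"
    by (rule o_bij[of "inv \<phi>"]) (simp_all add: fun_eq_iff inv1 inv2)
  then show ?thesis
    unfolding lipschitz_homeomorphism_def
    using forward.Lip_homeomorphism backward.Lip_homeomorphism by simp
qed

end
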